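(* Let $C\ge 1$ be an integer, let $\hat Y$ be a random variable with values in $\{1,\dots,C\}$ (the predicted hard label), and let $Y_{\mathrm{sem}}$ and $Y_w$ be label-valued random variables (the semantic label and the watermark target), each with values in $\{1,\dots,C\}$, all defined on a common probability space. Then $$I(\hat Y;Y_w\mid Y_{\mathrm{sem}})\;\le\;\log C-I(\hat Y;Y_{\mathrm{sem}}).$$ Consequently, as semantic prediction saturates the label channel, the capacity for an independent watermark collapses to zero: for any sequence of such triples $(\hat Y^{(n)},Y_{\mathrm{sem}}^{(n)},Y_w^{(n)})$ with $C$ fixed, with $I(Y_{\mathrm{sem}}^{(n)};Y_w^{(n)})=0$ for all $n$, and with $I(\hat Y^{(n)};Y_{\mathrm{sem}}^{(n)})\to\log C$, one has $I(\hat Y^{(n)};Y_w^{(n)}\mid Y_{\mathrm{sem}}^{(n)})\to 0$.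
   Context: $I(\cdot;\cdot)$ denotes mutual information and $I(\cdot;\cdot\mid\cdot)$ conditional mutual information, computed with the same logarithm as $\log C$. In the label-only paradigm the verifier of a $C$-class classifier $f$ observes only the hard label $\hat Y=\arg\max f(X)$. $Y_{\mathrm{sem}}$ is the true semantic class of the input, and $Y_w$ is the watermark target label; an independent watermark is one whose target is assigned independently of the semantic class, i.e. $I(Y_{\mathrm{sem}};Y_w)=0$. The information capacity available for the watermark signal, conditioned on the semantic task, is the quantity $I(\hat Y;Y_w\mid Y_{\mathrm{sem}})$. *)

theory Defs
  imports "HOL-Probability.Information"
begin

text \<open>
  Discrete (conditional) mutual information to base \<open>b\<close>. These are the abbreviations
  \<open>\<I>(X ; Y)\<close> and \<open>\<I>(X ; Y | Z)\<close> of the locale \<^locale>\<open>information_space\<close>, restated with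
  the probability space as an explicit argument because the space varies along a sequence.
\<close>

abbreviation MI :: "real \<Rightarrow> 'a measure \<Rightarrow> ('a \<Rightarrow> 'b) \<Rightarrow> ('a \<Rightarrow> 'c) \<Rightarrow> real" where
  "MI b M X Y \<equiv> prob_space.mutual_information M b
     (count_space (X ` space M)) (count_space (Y ` space M)) X Y"

abbreviation CMI :: "real \<Rightarrow> 'a measure \<Rightarrow> ('a \<Rightarrow> 'b) \<Rightarrow> ('a \<Rightarrow> 'c) \<Rightarrow> ('a \<Rightarrow> 'd) \<Rightarrow> real" where
  "CMI b M X Y Z \<equiv> prob_space.conditional_mutual_information M b
     (count_space (X ` space M)) (count_space (Y ` space M)) (count_space (Z ` space M)) X Y Z"

definition label_triple ::
  "nat \<Rightarrow> 'a measure \<Rightarrow> ('a \<Rightarrow> nat) \<Rightarrow> ('a \<Rightarrow> nat) \<Rightarrow> ('a \<Rightarrow> nat) \<Rightarrow> bool" where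
  "label_triple C M Yhat Ysem Yw \<longleftrightarrow>
     prob_space M \<and>
     Yhat \<in> measurable M (count_space {1..C}) \<and>
     Ysem \<in> measurable M (count_space {1..C}) \<and>
     Yw \<in> measurable M (count_space {1..C})"

end

theory Submission
  imports Defs
begin

text \<open>
  By the chain rule, \<open>I(X; Y | Z) + I(X; Z) = I(X; (Y, Z)) \<le> H(X) \<le> log C\<close>. The collapse to
  zero follows by squeezing, since conditional mutual information is nonnegative.
\<close>

text \<open>
  Conditional mutual information is defined on the full product of the ranges of \<open>Y\<close> and \<open>Z\<close>,
  which may be larger than the range of the pair. The library lemmas for simple functions only
  treat the exact range, hence the superset \<open>B\<close>.
\<close>

lemma (in information_space) mutual_information_le_entropy:
  assumes X: "simple_function M X" and W: "simple_function M W"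
    and B: "W ` space M \<subseteq> B" "finite B"
  shows "mutual_information b (count_space (X ` space M)) (count_space B) X W \<le> \<H>(X)"
proof -
  let ?S = "count_space (X ` space M)" and ?T = "count_space B"
  define Px where "Px x = prob (X -` {x} \<inter> space M)" for x
  \<comment> \<open>Points of \<open>B\<close> that \<open>W\<close> never attains get mass zero, so
    that \<open>Pw\<close> is a density with respect to counting measure on all of \<open>B\<close>;
    \<open>Pxw\<close> is extended in the same way.\<close>
  define Pw where "Pw w = (if w \<in> W ` space M then prob (W -` {w} \<inter> space M) else 0)" for w
  define Pxw where "Pxw p = (if p \<in> (\<lambda>x. (X x, W x)) ` space M
      then prob ((\<lambda>x. (X x, W x)) -` {p} \<inter> space M) else 0)" for p
  have finX: "finite (X ` space M)"
    using X by (rule simple_functionD)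
  have ST: "?S \<Otimes>\<^sub>M ?T = count_space (X ` space M \<times> B)"
    using finX B by (simp add: pair_measure_count_space)
  have S: "sigma_finite_measure ?S" and T: "sigma_finite_measure ?T"
    using finX B by (auto intro: sigma_finite_measure_count_space_finite)
  have dX: "distributed M ?S X Px"
    unfolding Px_def by (rule simple_distributed[OF simple_distributedI[OF X measure_nonneg refl]])
  have dW: "distributed M ?T W Pw"
    unfolding Pw_def by (rule distributed_simple_function_superset[OF W refl B])
  have dXW: "distributed M (?S \<Otimes>\<^sub>M ?T) (\<lambda>x. (X x, W x)) Pxw"
    unfolding ST Pxw_def using finX B
    by (intro distributed_simple_function_superset[OF simple_function_Pair[OF X W] refl]) auto
  have nn: "0 \<le> Px x" "0 \<le> Pw w" "0 \<le> Pxw p" for x w p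
    by (auto simp: Px_def Pw_def Pxw_def)
  \<comment> \<open>Both ranges are finite, so every real function is integrable; this settles all
    three integrability conditions of the entropy identity below.\<close>
  have int: "integrable (?S \<Otimes>\<^sub>M ?T) f" for f :: "_ \<Rightarrow> real"
    unfolding ST using finX B by (intro integrable_count_space) auto
  \<comment> \<open>The event X = x, W = w is contained in the event W = w. Hence the conditional
    probability \<open>Pxw (x, w) / Pw w\<close> is at most 1 and its logarithm is nonpositive
    wherever \<open>Pxw\<close> is positive.\<close>
  have Pxw_le: "Pxw (x, w) \<le> Pw w" for x w
    using W by (auto simp: Pxw_def Pw_def intro!: finite_measure_mono simple_functionD)
  have "Pxw (x, w) * log b (Pxw (x, w) / Pw w) \<le> 0" for x w
  proof (cases "Pxw (x, w) = 0")
    case False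
    then have "0 < Pxw (x, w)"
      using nn(3)[of "(x, w)"] by simp
    with Pxw_le[of x w] b_gt_1 show ?thesis
      by (intro mult_nonneg_nonpos) auto
  qed simp
  then have "(\<integral>(x, w). Pxw (x, w) * log b (Pxw (x, w) / Pw w) \<partial>(?S \<Otimes>\<^sub>M ?T)) \<le> 0"
    unfolding ST using finX B
    by (auto simp: lebesgue_integral_count_space_finite intro!: sum_nonpos)
  \<comment> \<open>H(X|W) is minus the integral just bounded.\<close>
  then have "0 \<le> conditional_entropy b ?S ?T X W"
    by (simp add: conditional_entropy_generic_eq[OF S T dW nn(2) dXW nn(3)])
  moreover have "mutual_information b ?S ?T X W = \<H>(X) - conditional_entropy b ?S ?T X W"
    by (rule mutual_information_eq_entropy_conditional_entropy'
        [OF S T dX nn(1) dW nn(2) dXW nn(3) int int int])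
  ultimately show ?thesis by simp
qed

text \<open>The chain rule comes for free: I(X; Y | Z) is defined as I(X; (Y, Z)) - I(X; Z). It
  remains to bound the first term by H(X), taking W = (Y, Z) and \<open>B\<close> the product of the
  two ranges.\<close>

lemma (in information_space) conditional_mutual_information_le:
  assumes X: "simple_function M X" and Y: "simple_function M Y" and Z: "simple_function M Z"
  shows "\<I>(X ; Y | Z) \<le> log b (real (card (X ` space M))) - \<I>(X ; Z)"
proof -
  have fin: "finite (Y ` space M)" "finite (Z ` space M)"
    using Y Z by (auto dest: simple_functionD)
  have "mutual_information b (count_space (X ` space M))
      (count_space (Y ` space M \<times> Z ` space M)) X (\<lambda>x. (Y x, Z x)) \<le> \<H>(X)"
    using fin by (intro mutual_information_le_entropy[OF X simple_function_Pair[OF Y Z]]) auto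
  also have "\<H>(X) \<le> log b (real (card (X ` space M)))"
    by (rule entropy_le_card[OF simple_distributedI[OF X measure_nonneg refl]])
  finally show ?thesis
    using fin by (simp add: conditional_mutual_information_def pair_measure_count_space)
qed

lemma simple_function_of_measurable_count_space:
  assumes "X \<in> measurable M (count_space A)" and "finite A"
  shows "simple_function M X"
  unfolding simple_function_def
proof
  have sub: "X ` space M \<subseteq> A"
    using measurable_space[OF assms(1)] by auto
  then show "finite (X ` space M)"
    using \<open>finite A\<close> by (rule finite_subset)
  show "\<forall>x\<in>X ` space M. X -` {x} \<inter> space M \<in> sets M"
    using sub by (intro ballI measurable_sets[OF assms(1)]) auto
qed

text \<open>These are the two sides of the squeeze; the upper one is also the first claim of the
  theorem.\<close>

lemma label_triple_CMI_bounds: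
  assumes L: "label_triple C M Yhat Ysem Yw" and b: "b > 1"
  shows "0 \<le> CMI b M Yhat Yw Ysem"
    and "CMI b M Yhat Yw Ysem \<le> log b (real C) - MI b M Yhat Ysem"
proof -
  interpret prob_space M
    using L by (simp add: label_triple_def)
  interpret information_space M b
    by unfold_locales (rule b)
  have meas: "Yhat \<in> measurable M (count_space {1..C})"
    using L by (simp add: label_triple_def)
  have sf: "simple_function M Yhat" "simple_function M Yw" "simple_function M Ysem"
    using L by (auto simp: label_triple_def intro: simple_function_of_measurable_count_space)
  show "0 \<le> CMI b M Yhat Yw Ysem"
    by (rule conditional_mutual_information_nonneg[OF sf])
  have sub: "Yhat ` space M \<subseteq> {1..C}"
    using measurable_space[OF meas] by auto
  have "card (Yhat ` space M) \<le> C"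
    using card_mono[OF _ sub] by simp
  \<comment> \<open>Some label is attained because a probability space is nonempty; monotonicity of
    \<open>log\<close> is applied to positive arguments.\<close>
  moreover have "0 < card (Yhat ` space M)"
    using sub not_empty by (auto simp: card_gt_0_iff intro: finite_subset)
  ultimately have "log b (real (card (Yhat ` space M))) \<le> log b (real C)"
    using b by simp
  with conditional_mutual_information_le[OF sf]
  show "CMI b M Yhat Yw Ysem \<le> log b (real C) - MI b M Yhat Ysem"
    by simp
qed

theorem proposition3:
  fixes C :: nat and b :: real
  assumes "C \<ge> 1" and "b > 1"
  shows
    "(\<forall>(M :: 'a measure) Yhat Ysem Yw.
        label_triple C M Yhat Ysem Yw \<longrightarrow>
        CMI b M Yhat Yw Ysem \<le> log b (real C) - MI b M Yhat Ysem)
     \<and>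
     (\<forall>(M :: nat \<Rightarrow> 'b measure) Yhat Ysem Yw.
        (\<forall>n. label_triple C (M n) (Yhat n) (Ysem n) (Yw n)) \<longrightarrow>
        (\<forall>n. MI b (M n) (Ysem n) (Yw n) = 0) \<longrightarrow>
        (\<lambda>n. MI b (M n) (Yhat n) (Ysem n)) \<longlonglongrightarrow> log b (real C) \<longrightarrow>
        (\<lambda>n. CMI b (M n) (Yhat n) (Yw n) (Ysem n)) \<longlonglongrightarrow> 0)"
proof (intro conjI allI impI)
  fix M :: "'a measure" and Yhat Ysem Yw
  assume "label_triple C M Yhat Ysem Yw"
  then show "CMI b M Yhat Yw Ysem \<le> log b (real C) - MI b M Yhat Ysem"
    using \<open>b > 1\<close> by (rule label_triple_CMI_bounds)
next
  fix M :: "nat \<Rightarrow> 'b measure" and Yhat Ysem Yw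
  assume L: "\<forall>n. label_triple C (M n) (Yhat n) (Ysem n) (Yw n)"
    and lim: "(\<lambda>n. MI b (M n) (Yhat n) (Ysem n)) \<longlonglongrightarrow> log b (real C)"
  \<comment> \<open>As \<open>C\<close> is fixed, saturation says exactly that the upper bound
    vanishes in the limit.\<close>
  have gap: "(\<lambda>n. log b (real C) - MI b (M n) (Yhat n) (Ysem n)) \<longlonglongrightarrow> 0"
    using tendsto_diff[OF tendsto_const lim, of "log b (real C)"] by simp
  show "(\<lambda>n. CMI b (M n) (Yhat n) (Yw n) (Ysem n)) \<longlonglongrightarrow> 0"
    by (rule tendsto_sandwich[OF _ _ tendsto_const gap])
      (intro always_eventually allI label_triple_CMI_bounds[OF L[rule_format] \<open>b > 1\<close>])+
qed

end
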